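(* Let $f:\mathbb{R}^n\to\mathbb{R}$, $f(x)=\|x\|_*$, be an arbitrary norm on $\mathbb{R}^n$. For $r>0$ define $g_r(x)=[e_r(f^2)](x)$ and $h_r=\sqrt{g_r}$. Then $h_r$ is a norm, $h_r$ is differentiable everywhere except at the origin, and $\lim_{r\nearrow\infty}h_r=f$ (pointwise).
   Context: $\mathbb{R}^n$ carries the Euclidean norm $\|\cdot\|$ (in general different from $\|\cdot\|_*$). For a proper lower semicontinuous $\varphi:\mathbb{R}^n\to\mathbb{R}\cup\{\infty\}$ and $r>0$, the Moreau envelope is $e_r\varphi(x)=\inf_{y\in\mathbb{R}^n}\{\varphi(y)+\frac r2\|y-x\|^2\}$. *)

theory Defs
  imports "HOL-Analysis.Analysis"
begin

text \<open>The type class \<open>real_normed_vector\<close> fixes a single norm per type (the Euclidean one on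
  \<open>real ^ 'n\<close>); this predicate expresses that an arbitrary function is a norm.\<close>

definition is_norm :: "('a::real_vector \<Rightarrow> real) \<Rightarrow> bool" where
  "is_norm N \<longleftrightarrow>
     (\<forall>x. 0 \<le> N x) \<and>
     (\<forall>x. N x = 0 \<longleftrightarrow> x = 0) \<and>
     (\<forall>c x. N (c *\<^sub>R x) = \<bar>c\<bar> * N x) \<and>
     (\<forall>x y. N (x + y) \<le> N x + N y)"

text \<open>The values lie in \<open>ereal\<close>, so the infimum always exists and no assumption (proper,
  lower semicontinuous) on \<open>\<phi>\<close> is needed for the definition to make sense.\<close>

definition moreau_envelope :: "real \<Rightarrow> ('a::euclidean_space \<Rightarrow> ereal) \<Rightarrow> 'a \<Rightarrow> ereal" where
  "moreau_envelope r \<phi> x = (INF y. \<phi> y + ereal (r / 2 * (norm (y - x))\<^sup>2))"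

text \<open>For the square of a real-valued function the envelope is finite, so that
  \<open>real_of_ereal\<close> loses no information.\<close>

lemma ereal_real_moreau_envelope_square:
  fixes f :: "'a::euclidean_space \<Rightarrow> real"
  assumes "0 < r"
  shows "ereal (real_of_ereal (moreau_envelope r (\<lambda>y. ereal ((f y)\<^sup>2)) x))
       = moreau_envelope r (\<lambda>y. ereal ((f y)\<^sup>2)) x"
proof -
  let ?e = "moreau_envelope r (\<lambda>y. ereal ((f y)\<^sup>2)) x"
  have lower: "0 \<le> ?e"
    using assms unfolding moreau_envelope_def by (intro INF_greatest) simp
  have "?e \<le> ereal ((f x)\<^sup>2) + ereal (r / 2 * (norm (x - x))\<^sup>2)"
    unfolding moreau_envelope_def by (rule INF_lower) simp
  then have upper: "?e \<le> ereal ((f x)\<^sup>2)"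
    by simp
  from lower upper have "\<bar>?e\<bar> \<noteq> \<infinity>"
    by auto
  then show ?thesis
    by (rule ereal_real')
qed

end

theory Submission
  imports Defs
begin

text \<open>The function \<open>(y, x) \<mapsto> sqrt ((f y)\<^sup>2 + r / 2 * \<parallel>y - x\<parallel>\<^sup>2)\<close> is subadditive and homogeneous on pairs,
  and \<open>h\<^sub>r\<close> is its minimum over \<open>y\<close>, so \<open>h\<^sub>r\<close> is a norm; in particular \<open>g\<^sub>r = h\<^sub>r\<^sup>2\<close> is convex.
  If \<open>p\<close> attains the minimum at \<open>x\<close>, then testing the envelope at \<open>x + z\<close> with \<open>p\<close> gives
  \<open>g\<^sub>r (x + z) \<le> g\<^sub>r x + r * ((x - p) \<bullet> z) + r / 2 * \<parallel>z\<parallel>\<^sup>2\<close>. Convexity turns the same bound for \<open>- z\<close> into a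
  matching lower bound, so \<open>g\<^sub>r\<close> has gradient \<open>r (x - p)\<close> at \<open>x\<close>. Finally, if \<open>f \<le> M \<parallel>\<cdot>\<parallel>\<close>, the
  Cauchy-Schwarz inequality gives \<open>f\<^sup>2 \<le> (1 + 2 M\<^sup>2 / r) g\<^sub>r\<close>, while \<open>g\<^sub>r \<le> f\<^sup>2\<close>; this yields both
  definiteness and the limit.\<close>

section \<open>Arbitrary norms on a Euclidean space: continuity and the kink at the origin\<close>

lemma is_normD:
  assumes "is_norm N"
  shows "0 \<le> N x" "N x = 0 \<longleftrightarrow> x = 0" "N (c *\<^sub>R x) = \<bar>c\<bar> * N x" "N (x + y) \<le> N x + N y"
  using assms unfolding is_norm_def by auto

lemma is_norm_bounded_by_norm:
  fixes N :: "'a::euclidean_space \<Rightarrow> real"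
  assumes "is_norm N"
  obtains M where "\<And>x. N x \<le> M * norm x"
proof
  fix x :: 'a
  have sum_le: "N (\<Sum>i\<in>I. u i) \<le> (\<Sum>i\<in>I. N (u i))" if "finite I" for I :: "'a set" and u
    using that
  proof induction
    case empty
    show ?case using is_normD(2)[OF assms, of 0] by simp
  next
    case (insert i I)
    then show ?case using is_normD(4)[OF assms, of "u i" "sum u I"] by simp
  qed
  have "N x = N (\<Sum>b\<in>Basis. (x \<bullet> b) *\<^sub>R b)"
    by (simp add: euclidean_representation)
  also have "\<dots> \<le> (\<Sum>b\<in>Basis. N ((x \<bullet> b) *\<^sub>R b))"
    by (rule sum_le) simp
  also have "\<dots> \<le> (\<Sum>b\<in>Basis. N b * norm x)"
    by (rule sum_mono)
      (simp add: is_normD(3)[OF assms] Basis_le_norm is_normD(1)[OF assms] mult.commute mult_left_mono)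
  finally show "N x \<le> (\<Sum>b\<in>Basis. N b) * norm x"
    by (simp add: sum_distrib_right)
qed

lemma is_norm_continuous:
  fixes N :: "'a::euclidean_space \<Rightarrow> real"
  assumes "is_norm N"
  shows "continuous_on S N"
proof -
  obtain M where M: "\<And>x. N x \<le> M * norm x"
    using is_norm_bounded_by_norm[OF assms] by blast
  have "N x - N y \<le> M * norm (x - y)" for x y
    using is_normD(4)[OF assms, of y "x - y"] M[of "x - y"] by simp
  then have lip: "\<bar>N x - N y\<bar> \<le> M * norm (x - y)" for x y
    by (smt (verit) norm_minus_commute)
  \<comment> \<open>A Lipschitz constant must be nonnegative; at a basis vector \<open>b\<close>,
    where \<open>norm b = 1\<close>, the bound reads \<open>0 \<le> N b \<le> M\<close>.\<close>
  have "0 \<le> M"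
    using M is_normD(1)[OF assms]
    by (metis One_nat_def SOME_Basis linorder_not_le mult.right_neutral norm_Basis order_trans)
  with lip have "M-lipschitz_on S N"
    by (intro lipschitz_onI) (auto simp: dist_real_def dist_norm)
  then show ?thesis
    by (rule lipschitz_on_continuous_on)
qed

text \<open>Along a line through the origin a norm is a positive multiple of the absolute value,
  whose one-sided slopes at 0 differ. Applied to \<open>h r\<close> itself, this makes the
  differentiability claim an equivalence.\<close>

lemma is_norm_not_differentiable_at_0:
  fixes N :: "'a::euclidean_space \<Rightarrow> real"
  assumes "is_norm N"
  shows "\<not> N differentiable (at 0)"
proof
  assume "N differentiable (at 0)"
  obtain b :: 'a where "b \<in> Basis"
    using nonempty_Basis by blast
  then have "N b \<noteq> 0"
    using is_normD(2)[OF assms] nonzero_Basis by blast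
  have "(\<lambda>t::real. N (t *\<^sub>R b)) differentiable (at 0)"
    by (rule differentiable_compose[where f = N]) (use \<open>N differentiable (at 0)\<close> in simp_all)
  then have "(\<lambda>t::real. \<bar>t\<bar> * N b * (1 / N b)) differentiable (at 0)"
    unfolding is_normD(3)[OF assms] by (rule differentiable_mult) simp
  moreover have "(\<lambda>t::real. \<bar>t\<bar> * N b * (1 / N b)) = abs"
    using \<open>N b \<noteq> 0\<close> by (simp add: fun_eq_iff)
  ultimately have "(abs :: real \<Rightarrow> real) differentiable (at 0)"
    by (simp only:)
  then obtain D where D: "((abs :: real \<Rightarrow> real) has_real_derivative D) (at 0)"
    by (auto simp: real_differentiable_def)
  then have "((\<lambda>t. \<bar>t\<bar> / t) \<longlongrightarrow> D) (at (0::real))"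
    by (simp add: has_field_derivative_iff)
  then have lr: "((\<lambda>t. \<bar>t\<bar> / t) \<longlongrightarrow> D) (at_left (0::real))" "((\<lambda>t. \<bar>t\<bar> / t) \<longlongrightarrow> D) (at_right (0::real))"
    by (simp_all add: filterlim_at_split)
  have "((\<lambda>t. \<bar>t\<bar> / t) \<longlongrightarrow> - 1) (at_left (0::real))"
    by (rule tendsto_eventually) (auto simp: eventually_at_left_field intro!: exI[of _ "-1"])
  moreover have "((\<lambda>t. \<bar>t\<bar> / t) \<longlongrightarrow> 1) (at_right (0::real))"
    by (rule tendsto_eventually) (auto simp: eventually_at_right_field intro!: exI[of _ "1"])
  ultimately have "D = - 1" "D = 1"
    using lr tendsto_unique trivial_limit_at_left_real trivial_limit_at_right_real by blast+
  then show False by simp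
qed

section \<open>The envelope of a square: attainment and comparison with the square\<close>

definition square_envelope :: "real \<Rightarrow> ('a::euclidean_space \<Rightarrow> real) \<Rightarrow> 'a \<Rightarrow> real" where
  "square_envelope r f x = real_of_ereal (moreau_envelope r (\<lambda>y. ereal ((f y)\<^sup>2)) x)"

lemma square_envelope_le:
  assumes "0 < r"
  shows "square_envelope r f x \<le> (f y)\<^sup>2 + r / 2 * (norm (y - x))\<^sup>2"
proof -
  have "ereal (square_envelope r f x) \<le> ereal ((f y)\<^sup>2) + ereal (r / 2 * (norm (y - x))\<^sup>2)"
    unfolding square_envelope_def ereal_real_moreau_envelope_square[OF assms]
    unfolding moreau_envelope_def by (rule INF_lower) simp
  then show ?thesis by simp
qed

lemma square_envelope_le_square:
  assumes "0 < r"
  shows "square_envelope r f x \<le> (f x)\<^sup>2"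
  using square_envelope_le[OF assms, of f x x] by simp

text \<open>A continuous function attains its minimum on a compact ball around \<open>x\<close>;
  outside a large enough ball the quadratic penalty alone exceeds the value of the objective at
  \<open>y = x\<close>, so the minimum is global.\<close>

lemma square_envelope_attained:
  fixes f :: "'a::euclidean_space \<Rightarrow> real"
  assumes "0 < r" and cont: "continuous_on UNIV f"
  obtains p where "square_envelope r f x = (f p)\<^sup>2 + r / 2 * (norm (p - x))\<^sup>2"
proof -
  let ?q = "\<lambda>y. (f y)\<^sup>2 + r / 2 * (norm (y - x))\<^sup>2"
  \<comment> \<open>Chosen so that \<open>r / 2 * R\<^sup>2 = (f x)\<^sup>2\<close>, the value of
    the objective at the centre.\<close>
  define R where "R = sqrt (2 / r) * \<bar>f x\<bar>"
  have "0 \<le> R" using assms by (simp add: R_def)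
  have "continuous_on (cball x R) ?q"
    by (intro continuous_intros continuous_on_subset[OF cont]) simp
  then obtain p where "\<forall>y\<in>cball x R. ?q p \<le> ?q y"
    using continuous_attains_inf[of "cball x R" ?q] \<open>0 \<le> R\<close> by auto
  then have p: "?q p \<le> ?q y" if "y \<in> cball x R" for y
    using that by blast
  have min: "?q p \<le> ?q y" for y
  proof (cases "y \<in> cball x R")
    case False
    then have "R\<^sup>2 \<le> (norm (y - x))\<^sup>2"
      using \<open>0 \<le> R\<close> by (intro power_mono) (auto simp: dist_norm norm_minus_commute)
    then have "(f x)\<^sup>2 \<le> r / 2 * (norm (y - x))\<^sup>2"
      using assms by (simp add: R_def power_mult_distrib field_simps)
    moreover have "?q p \<le> (f x)\<^sup>2"
      using p[of x] \<open>0 \<le> R\<close> by simp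
    ultimately show ?thesis
      using zero_le_power2[of "f y"] by linarith
  qed (rule p)
  have "moreau_envelope r (\<lambda>y. ereal ((f y)\<^sup>2)) x = ereal (?q p)"
    unfolding moreau_envelope_def plus_ereal.simps
    by (intro antisym INF_greatest INF_lower) (simp_all only: ereal_less_eq min UNIV_I)
  then show thesis
    by (intro that[of p]) (simp add: square_envelope_def)
qed

lemma square_envelope_nonneg:
  assumes "0 < r"
  shows "0 \<le> square_envelope r f x"
  unfolding square_envelope_def moreau_envelope_def
  using assms by (intro real_of_ereal_pos INF_greatest) simp

lemma square_le_square_envelope:
  fixes f :: "'a::euclidean_space \<Rightarrow> real"
  assumes f: "is_norm f" and "0 < r" and M: "\<And>x. f x \<le> M * norm x"
  shows "(f x)\<^sup>2 \<le> (1 + 2 * M\<^sup>2 / r) * square_envelope r f x"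
proof -
  obtain p where p: "square_envelope r f x = (f p)\<^sup>2 + r / 2 * (norm (p - x))\<^sup>2"
    using square_envelope_attained[OF \<open>0 < r\<close> is_norm_continuous[OF f]] .
  let ?a = "f p" and ?b = "norm (p - x)"
  have "f x \<le> ?a + M * ?b"
    using is_normD(4)[OF f, of p "x - p"] M[of "x - p"] by (simp add: norm_minus_commute)
  then have "(f x)\<^sup>2 \<le> (?a + M * ?b)\<^sup>2"
    using is_normD(1)[OF f] by (intro power_mono)
  also have "\<dots> \<le> (1 + 2 * M\<^sup>2 / r) * (?a\<^sup>2 + r / 2 * ?b\<^sup>2)"
  proof -
    \<comment> \<open>Cauchy-Schwarz for the plane vectors \<open>(1, M * sqrt (2 / r))\<close> and
      \<open>(?a, sqrt (r / 2) * ?b)\<close>, with its defect written as an explicit square.\<close>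
    have "(1 + 2 * M\<^sup>2 / r) * (?a\<^sup>2 + r / 2 * ?b\<^sup>2) - (?a + M * ?b)\<^sup>2 = (2 * M * ?a - r * ?b)\<^sup>2 / (2 * r)"
      using \<open>0 < r\<close> by (simp add: field_simps power2_eq_square)
    moreover have "0 \<le> (2 * M * ?a - r * ?b)\<^sup>2 / (2 * r)"
      using \<open>0 < r\<close> by simp
    ultimately show ?thesis by linarith
  qed
  finally show ?thesis by (simp only: p)
qed

lemma square_envelope_eq_0_iff:
  fixes f :: "'a::euclidean_space \<Rightarrow> real"
  assumes "is_norm f" and "0 < r"
  shows "square_envelope r f x = 0 \<longleftrightarrow> x = 0"
proof
  assume 0: "square_envelope r f x = 0"
  obtain M where M: "\<And>x. f x \<le> M * norm x"
    using is_norm_bounded_by_norm[OF assms(1)] by blast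
  have "(f x)\<^sup>2 \<le> 0"
    using square_le_square_envelope[OF assms M, of x] 0 by simp
  then show "x = 0"
    using is_normD(2)[OF assms(1), of x] by simp
next
  assume "x = 0"
  then have "f x = 0"
    using is_normD(2)[OF assms(1)] by simp
  then show "square_envelope r f x = 0"
    using square_envelope_le_square[OF assms(2), of f x] square_envelope_nonneg[OF assms(2), of f x] by simp
qed

section \<open>The norm axioms for the root of the envelope\<close>

lemma is_norm_sqrt_square_envelope:
  fixes f :: "'a::euclidean_space \<Rightarrow> real"
  assumes f: "is_norm f" and "0 < r"
  shows "is_norm (\<lambda>x. sqrt (square_envelope r f x))"
proof -
  let ?g = "square_envelope r f"
  note attained = square_envelope_attained[OF \<open>0 < r\<close> is_norm_continuous[OF f]]
  \<comment> \<open>If \<open>p\<close> is a minimiser at \<open>x\<close>, then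
    \<open>c *\<^sub>R p\<close> is a competitor at \<open>c *\<^sub>R x\<close>. For nonzero
    \<open>c\<close>, the reverse inequality follows by scaling back with
    \<open>inverse c\<close>.\<close>
  have scale_le: "?g (c *\<^sub>R x) \<le> c\<^sup>2 * ?g x" for c x
  proof -
    obtain p where p: "?g x = (f p)\<^sup>2 + r / 2 * (norm (p - x))\<^sup>2"
      using attained .
    have "?g (c *\<^sub>R x) \<le> (f (c *\<^sub>R p))\<^sup>2 + r / 2 * (norm (c *\<^sub>R p - c *\<^sub>R x))\<^sup>2"
      by (rule square_envelope_le[OF \<open>0 < r\<close>])
    also have "\<dots> = c\<^sup>2 * ?g x"
      unfolding p scaleR_diff_right[symmetric] norm_scaleR is_normD(3)[OF f]
      by (simp add: power_mult_distrib algebra_simps)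
    finally show ?thesis .
  qed
  have scale: "?g (c *\<^sub>R x) = c\<^sup>2 * ?g x" for c x
  proof (cases "c = 0")
    case True
    then show ?thesis using square_envelope_eq_0_iff[OF assms, of 0] by simp
  next
    case False
    then have "c\<^sup>2 * ?g x \<le> c\<^sup>2 * ((inverse c)\<^sup>2 * ?g (c *\<^sub>R x))"
      using scale_le[of "inverse c" "c *\<^sub>R x"] by (intro mult_left_mono) simp_all
    also have "\<dots> = ?g (c *\<^sub>R x)"
      using False by (simp add: field_simps)
    finally show ?thesis using scale_le[of c x] by simp
  qed
  have triangle: "sqrt (?g (x + y)) \<le> sqrt (?g x) + sqrt (?g y)" for x y
  proof -
    obtain p where p: "?g x = (f p)\<^sup>2 + r / 2 * (norm (p - x))\<^sup>2"
      using attained .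
    obtain q where q: "?g y = (f q)\<^sup>2 + r / 2 * (norm (q - y))\<^sup>2"
      using attained .
    \<comment> \<open>Absorbing \<open>r / 2\<close> into the distance turns the objective into the
      squared Euclidean length of the plane vector \<open>(f p, s * norm (p - x))\<close>, so the
      triangle inequality in the plane applies to the competitor \<open>p + q\<close>.\<close>
    define s where "s = sqrt (r / 2)"
    have s: "0 \<le> s" "r / 2 = s\<^sup>2" using \<open>0 < r\<close> by (simp_all add: s_def)
    have "norm ((p + q) - (x + y)) \<le> norm (p - x) + norm (q - y)"
      by (rule norm_diff_triangle_ineq)
    then have "?g (x + y) \<le> (f p + f q)\<^sup>2 + r / 2 * (norm (p - x) + norm (q - y))\<^sup>2"
      using \<open>0 < r\<close> is_normD(1,4)[OF f]
      by (intro order_trans[OF square_envelope_le[OF \<open>0 < r\<close>, of _ _ "p + q"]] add_mono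
          mult_left_mono power_mono) auto
    then have "sqrt (?g (x + y)) \<le> sqrt ((f p + f q)\<^sup>2 + (s * norm (p - x) + s * norm (q - y))\<^sup>2)"
      unfolding s(2) by (simp add: power_mult_distrib flip: distrib_left)
    also have "\<dots> \<le> sqrt (?g x) + sqrt (?g y)"
      unfolding p q s(2) power_mult_distrib[symmetric]
      by (rule real_sqrt_sum_squares_triangle_ineq)
    finally show ?thesis .
  qed
  show ?thesis
    unfolding is_norm_def
    using square_envelope_nonneg[OF \<open>0 < r\<close>] square_envelope_eq_0_iff[OF assms] triangle
    by (auto simp: scale real_sqrt_mult)
qed

section \<open>Differentiability of the envelope\<close>

lemma square_envelope_differentiable:
  fixes f :: "'a::euclidean_space \<Rightarrow> real"
  assumes f: "is_norm f" and "0 < r"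
  shows "square_envelope r f differentiable (at x)"
proof -
  let ?g = "square_envelope r f"
  obtain p where p: "?g x = (f p)\<^sup>2 + r / 2 * (norm (p - x))\<^sup>2"
    using square_envelope_attained[OF \<open>0 < r\<close> is_norm_continuous[OF f]] .
  have upper: "?g (x + z) \<le> ?g x + r * ((x - p) \<bullet> z) + r / 2 * (norm z)\<^sup>2" for z
  proof -
    have "?g (x + z) \<le> (f p)\<^sup>2 + r / 2 * (norm (p - (x + z)))\<^sup>2"
      by (rule square_envelope_le[OF \<open>0 < r\<close>])
    also have "\<dots> = ?g x + r * ((x - p) \<bullet> z) + r / 2 * (norm z)\<^sup>2"
      unfolding p power2_norm_eq_inner by (simp add: algebra_simps inner_commute)
    finally show ?thesis .
  qed
  \<comment> \<open>Only midpoint convexity is needed: \<open>?h\<close> is a norm and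
    \<open>2 *\<^sub>R x\<close> is the sum of \<open>x + z\<close> and \<open>x - z\<close>;
    squaring uses \<open>(a + b)\<^sup>2 \<le> 2 * (a\<^sup>2 + b\<^sup>2)\<close>.\<close>
  have convex: "2 * ?g x \<le> ?g (x + z) + ?g (x - z)" for z
  proof -
    let ?h = "\<lambda>x. sqrt (?g x)"
    note h = is_normD[OF is_norm_sqrt_square_envelope[OF assms]]
    have "2 * ?h x \<le> ?h (x + z) + ?h (x - z)"
      using h(4)[of "x + z" "x - z"] h(3)[of 2 x] by (simp add: scaleR_2)
    then have "(2 * ?h x)\<^sup>2 \<le> (?h (x + z) + ?h (x - z))\<^sup>2"
      using h(1)[of x] by (intro power_mono) auto
    also have "\<dots> \<le> 2 * ((?h (x + z))\<^sup>2 + (?h (x - z))\<^sup>2)"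
      using sum_squares_bound[of "?h (x + z)" "?h (x - z)"] by (simp add: power2_sum)
    finally show ?thesis
      by (simp add: power_mult_distrib square_envelope_nonneg[OF \<open>0 < r\<close>])
  qed
  \<comment> \<open>For the lower half, \<open>?g (x + z) \<ge> 2 * ?g x - ?g (x - z)\<close>, and
    \<open>upper\<close> at \<open>- z\<close> bounds the last term.\<close>
  have bound: "\<bar>?g (x + z) - ?g x - r * ((x - p) \<bullet> z)\<bar> \<le> r / 2 * (norm z)\<^sup>2" for z
    using upper[of z] upper[of "- z"] convex[of z]
    unfolding inner_minus_right norm_minus_cancel add_uminus_conv_diff by linarith
  have "(?g has_derivative (\<lambda>z. r * ((x - p) \<bullet> z))) (at x)"
    unfolding has_derivative_at
  proof (intro conjI)
    show "bounded_linear (\<lambda>z. r * ((x - p) \<bullet> z))"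
      by (intro bounded_linear_const_mult bounded_linear_inner_right)
    show "(\<lambda>z. norm (?g (x + z) - ?g x - r * ((x - p) \<bullet> z)) / norm z) \<midarrow>0\<rightarrow> 0"
    proof (rule tendsto_sandwich)
      show "\<forall>\<^sub>F z in at 0. 0 \<le> norm (?g (x + z) - ?g x - r * ((x - p) \<bullet> z)) / norm z"
        by simp
      show "\<forall>\<^sub>F z in at 0. norm (?g (x + z) - ?g x - r * ((x - p) \<bullet> z)) / norm z \<le> r / 2 * norm z"
        unfolding eventually_at_filter
        using bound by (intro always_eventually) (simp add: divide_simps power2_eq_square mult.assoc)
      show "(\<lambda>z::'a. r / 2 * norm z) \<midarrow>0\<rightarrow> 0"
        by (rule tendsto_eq_intros refl tendsto_norm_zero tendsto_ident_at | simp)+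
    qed simp
  qed
  then show ?thesis
    by (rule differentiableI)
qed

section \<open>The limit for growing penalty\<close>

lemma square_envelope_tendsto:
  fixes f :: "'a::euclidean_space \<Rightarrow> real"
  assumes f: "is_norm f"
  shows "((\<lambda>r. square_envelope r f x) \<longlongrightarrow> (f x)\<^sup>2) at_top"
proof -
  obtain M where M: "\<And>x. f x \<le> M * norm x"
    using is_norm_bounded_by_norm[OF f] by blast
  show ?thesis
  proof (rule tendsto_sandwich)
    \<comment> \<open>The constant \<open>M\<close> depends on \<open>f\<close> alone, so the
      denominator tends to 1 as \<open>r\<close> grows.\<close>
    show "\<forall>\<^sub>F r in at_top. (f x)\<^sup>2 / (1 + 2 * M\<^sup>2 / r) \<le> square_envelope r f x"
      using eventually_gt_at_top[of 0]
    proof eventually_elim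
      case (elim r)
      then have "0 < 1 + 2 * M\<^sup>2 / r"
        by (intro add_pos_nonneg) simp_all
      then show ?case
        using square_le_square_envelope[OF f elim M, of x]
        by (simp only: pos_divide_le_eq mult.commute)
    qed
    show "\<forall>\<^sub>F r in at_top. square_envelope r f x \<le> (f x)\<^sup>2"
      using eventually_gt_at_top[of 0] by eventually_elim (rule square_envelope_le_square)
    have "((\<lambda>r. 2 * M\<^sup>2 / r) \<longlongrightarrow> 0) at_top"
      by (intro tendsto_divide_0[OF tendsto_const] filterlim_at_top_imp_at_infinity filterlim_ident)
    then have "((\<lambda>r. (f x)\<^sup>2 / (1 + 2 * M\<^sup>2 / r)) \<longlongrightarrow> (f x)\<^sup>2 / (1 + 0)) at_top"
      by (intro tendsto_divide tendsto_add tendsto_const) simp_all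
    then show "((\<lambda>r. (f x)\<^sup>2 / (1 + 2 * M\<^sup>2 / r)) \<longlongrightarrow> (f x)\<^sup>2) at_top"
      by simp
  qed simp
qed

theorem corollary5p7:
  fixes f :: "real ^ 'n \<Rightarrow> real"
    and g h :: "real \<Rightarrow> real ^ 'n \<Rightarrow> real"
  assumes f: "is_norm f"
    and g: "\<And>r x. 0 < r \<Longrightarrow> g r x = real_of_ereal (moreau_envelope r (\<lambda>y. ereal ((f y)\<^sup>2)) x)"
    and h: "\<And>r x. 0 < r \<Longrightarrow> h r x = sqrt (g r x)"
  shows "(\<forall>r>0. is_norm (h r)) \<and>
         (\<forall>r>0. \<forall>x. h r differentiable (at x) \<longleftrightarrow> x \<noteq> 0) \<and>
         (\<forall>x. ((\<lambda>r. h r x) \<longlongrightarrow> f x) at_top)"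
proof (intro conjI allI impI)
  have h_eq: "h r = (\<lambda>x. sqrt (square_envelope r f x))" if "0 < r" for r
    using that by (simp add: fun_eq_iff g h square_envelope_def)
  fix r :: real assume "0 < r"
  then show norm_h: "is_norm (h r)"
    using is_norm_sqrt_square_envelope[OF f] h_eq by simp
  fix x
  show "h r differentiable (at x) \<longleftrightarrow> x \<noteq> 0"
  proof
    assume "h r differentiable (at x)"
    then show "x \<noteq> 0"
      using is_norm_not_differentiable_at_0[OF norm_h] by auto
  next
    assume "x \<noteq> 0"
    then have "0 < square_envelope r f x"
      using square_envelope_nonneg[OF \<open>0 < r\<close>, of f x] square_envelope_eq_0_iff[OF f \<open>0 < r\<close>, of x]
      by linarith
    then have "sqrt differentiable (at (square_envelope r f x))"
      using DERIV_real_sqrt real_differentiable_def by blast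
    then show "h r differentiable (at x)"
      unfolding h_eq[OF \<open>0 < r\<close>]
      by (rule differentiable_compose) (rule square_envelope_differentiable[OF f \<open>0 < r\<close>])
  qed
next
  fix x
  have "((\<lambda>r. sqrt (square_envelope r f x)) \<longlongrightarrow> f x) at_top"
    using tendsto_real_sqrt[OF square_envelope_tendsto[OF f, of x]] is_normD(1)[OF f, of x] by simp
  then show "((\<lambda>r. h r x) \<longlongrightarrow> f x) at_top"
    \<comment> \<open>The equations for \<open>g\<close> and \<open>h\<close> hold only for positive
      \<open>r\<close>, hence the two functions of \<open>r\<close> agree only eventually.\<close>
    by (rule Lim_transform_eventually)
      (use eventually_gt_at_top[of 0] in eventually_elim, simp add: g h square_envelope_def)
qed

end
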